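(* Let $$A=\begin{bmatrix}1&1\\-1&-1\end{bmatrix},\qquad D=\begin{bmatrix}1&0\\0&-1\end{bmatrix},\qquad B=DA=\begin{bmatrix}1&1\\1&1\end{bmatrix}.$$ Then $\rho(A)=0$ and $\rho(B)=\|A\|_2=2$. Hence for any absolute norm $\|\cdot\|_{\mathbb{R}}$ on $\mathbb{R}^2$ the induced operator norm satisfies $\|A\|_{\mathbb{R}}\ge 2$, and this inequality is sharp (equality is attained by some absolute norm on $\mathbb{R}^2$).
   Context: $\rho$ denotes the spectral radius (maximum modulus of all complex eigenvalues). $\|A\|_2$ is the operator norm of $A$ induced by the Euclidean norm on $\mathbb{R}^2$. A norm $\|\cdot\|_{\mathbb{R}}$ on $\mathbb{R}^2$ is called absolute if $\|(x_1,x_2)^\top\|_{\mathbb{R}}=\|(|x_1|,|x_2|)^\top\|_{\mathbb{R}}$ for all $(x_1,x_2)^\top\in\mathbb{R}^2$. The induced operator norm is $\|A\|_{\mathbb{R}}=\max\{\|A\mathbf{x}\|_{\mathbb{R}} : \mathbf{x}\in\mathbb{R}^2,\ \|\mathbf{x}\|_{\mathbb{R}}\le 1\}$. *)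

theory Defs
  imports "HOL-Analysis.Analysis" "Jordan_Normal_Form.Spectral_Radius"
begin

text \<open>
  Matrices over \<open>real ^ 2 ^ 2\<close> are used for linear maps of the Euclidean plane. The spectral radius
  of the library is defined for complex matrices with carrier, so a real 2 by 2 matrix is first
  regarded as such a complex matrix.
\<close>

definition complex_mat2 :: "real ^ 2 ^ 2 \<Rightarrow> complex mat" where
  "complex_mat2 A = mat_of_rows_list 2
     [[complex_of_real (vec_nth (vec_nth A 1) 1), complex_of_real (vec_nth (vec_nth A 1) 2)],
      [complex_of_real (vec_nth (vec_nth A 2) 1), complex_of_real (vec_nth (vec_nth A 2) 2)]]"

definition rho :: "real ^ 2 ^ 2 \<Rightarrow> real" where
  "rho A = spectral_radius (complex_mat2 A)"

definition is_norm :: "(real ^ 2 \<Rightarrow> real) \<Rightarrow> bool" where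
  "is_norm N \<longleftrightarrow>
     (\<forall>x. 0 \<le> N x) \<and>
     (\<forall>x. N x = 0 \<longleftrightarrow> x = 0) \<and>
     (\<forall>c x. N (c *\<^sub>R x) = \<bar>c\<bar> * N x) \<and>
     (\<forall>x y. N (x + y) \<le> N x + N y)"

definition absolute_norm :: "(real ^ 2 \<Rightarrow> real) \<Rightarrow> bool" where
  "absolute_norm N \<longleftrightarrow>
     is_norm N \<and>
     (\<forall>x1 x2. N (vector [x1, x2]) = N (vector [\<bar>x1\<bar>, \<bar>x2\<bar>]))"

text \<open>
  The maximum below ranges over an infinite set, so \<open>Max\<close> is not applicable. If \<open>N\<close> is a norm,
  the maximum exists by compactness of the closed unit ball of \<open>N\<close>.
\<close>

definition induced_norm :: "(real ^ 2 \<Rightarrow> real) \<Rightarrow> real ^ 2 ^ 2 \<Rightarrow> real" where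
  "induced_norm N A = (GREATEST r. \<exists>x. N x \<le> 1 \<and> r = N (A *v x))"

end

theory Submission
  imports Defs
begin

text \<open>
  The matrix \<open>A\<close> sends \<open>x\<close> to \<open>(x1 + x2) (1, -1)\<close>. An absolute norm takes the same value on
  \<open>(1, 1)\<close> and \<open>(1, -1) = A (1, 1) / 2\<close>, so \<open>A\<close> stretches \<open>(1, 1)\<close> by the factor 2. For the
  Euclidean norm the bound 2 is reached by Cauchy--Schwarz.
\<close>

lemma det_2x2:
  assumes "M \<in> carrier_mat 2 2"
  shows "Determinant.det M = M $$ (0, 0) * M $$ (1, 1) - M $$ (0, 1) * M $$ (1, 0)"
  using assms
  by (simp add: laplace_expansion_row[of M 2 0] lessThan_atLeast0 numeral_2_eq_2 cofactor_def
      det_single mat_delete_def)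

text \<open>This is the characteristic equation \<open>det (A - k I) = 0\<close>, with the
  off-diagonal product moved to the right. For a concrete matrix it becomes a scalar quadratic
  equation in \<open>k\<close>.\<close>

lemma eigenvalue_complex_mat2:
  "eigenvalue (complex_mat2 A) k \<longleftrightarrow>
    (complex_of_real (A $ 1 $ 1) - k) * (complex_of_real (A $ 2 $ 2) - k) =
    complex_of_real (A $ 1 $ 2 * A $ 2 $ 1)"
proof -
  have carrier: "complex_mat2 A \<in> carrier_mat 2 2"
    by (simp add: complex_mat2_def mat_of_rows_list_def numeral_2_eq_2)
  show ?thesis
    unfolding eigenvalue_det[OF carrier] det_2x2[OF char_matrix_closed[OF carrier]]
    by (simp add: char_matrix_def complex_mat2_def mat_of_rows_list_def)
qed

lemma rho_eq_Max: "rho A = Max (cmod ` {k. eigenvalue (complex_mat2 A) k})"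
  by (simp add: rho_def spectral_radius_def spectrum_def)

text \<open>Homogeneity and the triangle inequality make \<open>N\<close> convex, and a convex
  function on an open set of a finite-dimensional space is continuous.\<close>

lemma is_norm_continuous:
  assumes "is_norm N"
  shows "continuous_on UNIV N"
proof (rule convex_on_continuous)
  show "convex_on UNIV N"
  proof (rule convex_onI)
    fix t :: real and x y
    assume t: "0 < t" "t < 1"
    have "N ((1 - t) *\<^sub>R x + t *\<^sub>R y) \<le> N ((1 - t) *\<^sub>R x) + N (t *\<^sub>R y)"
      using assms unfolding is_norm_def by blast
    also have "\<dots> = (1 - t) * N x + t * N y"
      using assms t by (simp add: is_norm_def)
    finally show "N ((1 - t) *\<^sub>R x + t *\<^sub>R y) \<le> (1 - t) * N x + t * N y" .
  qed simp
qed simp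

text \<open>On the compact Euclidean unit sphere \<open>N\<close> attains a minimum, which is
  positive. By homogeneity \<open>N\<close> dominates that multiple of the Euclidean norm, so its
  unit ball is bounded; continuity makes it closed.\<close>

lemma is_norm_ball_compact:
  assumes N: "is_norm N"
  shows "compact {x. N x \<le> 1}"
proof -
  have "\<exists>z\<in>sphere 0 1. \<forall>y\<in>sphere 0 1. N z \<le> N y"
    by (rule continuous_attains_inf)
      (auto intro: continuous_on_subset[OF is_norm_continuous[OF N]])
  then obtain z where z: "norm z = 1" and z_min: "\<And>y. norm y = 1 \<Longrightarrow> N z \<le> N y"
    by auto
  from z have "z \<noteq> 0" by auto
  then have pos: "N z > 0"
    using N by (auto simp: is_norm_def less_le)
  have lower: "norm x * N z \<le> N x" for x
  proof (cases "x = 0")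
    case True
    then show ?thesis using N by (simp add: is_norm_def)
  next
    case False
    then have "N z \<le> N ((1 / norm x) *\<^sub>R x)"
      by (intro z_min) simp
    also have "\<dots> = N x / norm x"
      using N by (simp only: is_norm_def) simp
    finally show ?thesis
      using False by (simp add: field_simps)
  qed
  have "norm x \<le> 1 / N z" if "N x \<le> 1" for x
    using order_trans[OF lower that] pos by (simp add: field_simps)
  then have "bounded {x. N x \<le> 1}"
    unfolding bounded_iff by blast
  moreover have "closed {x. N x \<le> 1}"
    using continuous_on_closed_Collect_le[OF is_norm_continuous[OF N] continuous_on_const] by simp
  ultimately show ?thesis
    by (simp add: compact_eq_bounded_closed)
qed

text \<open>\<open>GREATEST\<close> says something only once a greatest value is known to exist.
  Here a continuous function on the compact unit ball of \<open>N\<close> attains its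
  supremum.\<close>

lemma induced_norm_upper:
  assumes N: "is_norm N" and x: "N x \<le> 1"
  shows "N (M *v x) \<le> induced_norm N M"
proof -
  have "continuous_on {x. N x \<le> 1} (\<lambda>x. N (M *v x))"
    by (rule continuous_on_compose2[OF is_norm_continuous[OF N]])
      (auto intro: linear_continuous_on)
  then have "\<exists>z\<in>{x. N x \<le> 1}. \<forall>y\<in>{x. N x \<le> 1}. N (M *v y) \<le> N (M *v z)"
    using x by (intro continuous_attains_sup is_norm_ball_compact[OF N]) auto
  then obtain z where z: "N z \<le> 1" and z_max: "\<And>y. N y \<le> 1 \<Longrightarrow> N (M *v y) \<le> N (M *v z)"
    by auto
  then have "induced_norm N M = N (M *v z)"
    unfolding induced_norm_def by (intro Greatest_equality) auto
  with z_max[OF x] show ?thesis by simp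
qed

lemma induced_norm_ge_2:
  assumes N: "absolute_norm N"
  shows "2 \<le> induced_norm N (vector [vector [1, 1], vector [-1, -1]])"
proof -
  let ?A = "vector [vector [1, 1], vector [-1, -1]] :: real ^ 2 ^ 2"
  let ?u = "vector [1, 1] :: real ^ 2"
  from N have "is_norm N" by (simp add: absolute_norm_def)
  then have scale: "N (c *\<^sub>R x) = \<bar>c\<bar> * N x" for c x
    by (simp add: is_norm_def)
  have "?u \<noteq> 0" by (simp add: Finite_Cartesian_Product.vec_eq_iff forall_2)
  then have pos: "N ?u > 0"
    using \<open>is_norm N\<close> by (auto simp: is_norm_def less_le)
  have "N (vector [1, -1]) = N (vector [\<bar>1\<bar>, \<bar>-1\<bar>])"
    using N unfolding absolute_norm_def by blast
  then have flip: "N (vector [1, -1]) = N ?u" by simp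
  \<comment> \<open>Scaling by \<open>1 / N ?u\<close> puts the test vector on the unit sphere of
    \<open>N\<close>.\<close>
  have "?A *v ((1 / N ?u) *\<^sub>R ?u) = (2 / N ?u) *\<^sub>R vector [1, -1]"
    by (simp add: Finite_Cartesian_Product.vec_eq_iff forall_2 matrix_vector_mult_def sum_2)
  then have "N (?A *v ((1 / N ?u) *\<^sub>R ?u)) = 2"
    using pos by (simp add: scale flip)
  moreover have "N ((1 / N ?u) *\<^sub>R ?u) \<le> 1"
    using pos by (simp add: scale)
  ultimately show ?thesis
    using induced_norm_upper[OF \<open>is_norm N\<close>] by metis
qed

lemma absolute_norm_norm: "absolute_norm norm"
proof -
  have "is_norm norm"
    by (simp add: is_norm_def norm_triangle_ineq)
  then show ?thesis
    by (simp add: absolute_norm_def norm_vec_def L2_set_def sum_2)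
qed

lemma euclidean_norm_mult_vec_le:
  fixes x :: "real ^ 2"
  shows "norm ((vector [vector [1, 1], vector [-1, -1]] :: real ^ 2 ^ 2) *v x) \<le> 2 * norm x"
proof -
  \<comment> \<open>The right side exceeds the left by
    \<open>2 * (x $ 1 - x $ 2)\<^sup>2\<close>.\<close>
  have "2 * (x $ 1 + x $ 2)\<^sup>2 \<le> 2\<^sup>2 * ((x $ 1)\<^sup>2 + (x $ 2)\<^sup>2)"
    using zero_le_power2[of "x $ 1 - x $ 2"] by (simp add: power2_eq_square algebra_simps)
  \<comment> \<open>The two coordinates of the image are opposite, so their squares add up to twice
    one square.\<close>
  then have "(x $ 1 + x $ 2)\<^sup>2 + (- (x $ 1) - x $ 2)\<^sup>2 \<le> 2\<^sup>2 * ((x $ 1)\<^sup>2 + (x $ 2)\<^sup>2)"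
    by (simp add: power2_eq_square algebra_simps)
  then have "sqrt ((x $ 1 + x $ 2)\<^sup>2 + (- (x $ 1) - x $ 2)\<^sup>2)
      \<le> sqrt (2\<^sup>2) * sqrt ((x $ 1)\<^sup>2 + (x $ 2)\<^sup>2)"
    unfolding real_sqrt_mult[symmetric] by (rule real_sqrt_le_mono)
  then show ?thesis
    by (simp add: norm_vec_def L2_set_def sum_2 matrix_vector_mult_def del: real_sqrt_le_iff)
qed

theorem corollary3p2:
  fixes A D B :: "real ^ 2 ^ 2"
  assumes "A = vector [vector [1, 1], vector [-1, -1]]"
    and "D = vector [vector [1, 0], vector [0, -1]]"
    and "B = D ** A"
  shows "B = vector [vector [1, 1], vector [1, 1]]
    \<and> rho A = 0 \<and> rho B = 2 \<and> onorm (\<lambda>x. A *v x) = 2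
    \<and> (\<forall>N. absolute_norm N \<longrightarrow> 2 \<le> induced_norm N A)
    \<and> (\<exists>N. absolute_norm N \<and> induced_norm N A = 2)"
proof (intro conjI)
  show B: "B = vector [vector [1, 1], vector [1, 1]]"
    by (simp add: assms Finite_Cartesian_Product.vec_eq_iff forall_2 matrix_matrix_mult_def sum_2)
  \<comment> \<open>The characteristic equation \<open>(1 - k) * (-1 - k) = -1\<close> reduces to
    \<open>k\<^sup>2 = 0\<close>.\<close>
  have "{k. eigenvalue (complex_mat2 A) k} = {0}"
    by (auto simp: eigenvalue_complex_mat2 assms(1) algebra_simps)
  then show "rho A = 0"
    by (simp add: rho_eq_Max)
  have "(1 - k) * (1 - k) = 1 \<longleftrightarrow> k = 0 \<or> k = 2" for k :: complex
  proof -
    have "(1 - k) * (1 - k) - 1 = k * (k - 2)" by (simp add: algebra_simps)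
    then show ?thesis by (metis eq_iff_diff_eq_0 mult_eq_0_iff)
  qed
  then have "{k. eigenvalue (complex_mat2 B) k} = {0, 2}"
    by (auto simp: eigenvalue_complex_mat2 B)
  then show "rho B = 2"
    by (simp add: rho_eq_Max)
  have upper: "norm (A *v x) \<le> 2 * norm x" for x
    using euclidean_norm_mult_vec_le by (simp add: assms(1))
  show "\<forall>N. absolute_norm N \<longrightarrow> 2 \<le> induced_norm N A"
    using induced_norm_ge_2 by (simp add: assms(1))
  let ?u = "vector [1, 1] :: real ^ 2"
  \<comment> \<open>The image of \<open>?u\<close> is \<open>(2, -2)\<close>, of length
    \<open>sqrt 8\<close>; the instance of \<open>real_sqrt_mult\<close> rewrites this as
    \<open>2 * sqrt 2\<close>. Thus \<open>?u\<close> attains the upper bound 2.\<close>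
  have u: "norm ?u = sqrt 2" "norm (A *v ?u) = 2 * norm ?u"
    by (simp_all add: assms(1) norm_vec_def L2_set_def sum_2 matrix_vector_mult_def
        real_sqrt_mult[of 4 2, simplified])
  show "onorm (\<lambda>x. A *v x) = 2"
  proof (rule antisym)
    show "onorm (\<lambda>x. A *v x) \<le> 2"
      by (rule onorm_bound) (auto intro: upper)
    have "2 * norm ?u \<le> onorm (\<lambda>x. A *v x) * norm ?u"
      using onorm[OF matrix_vector_mul_bounded_linear, of A ?u] u by simp
    then show "2 \<le> onorm (\<lambda>x. A *v x)"
      using u by simp
  qed
  have "induced_norm norm A = 2"
    unfolding induced_norm_def
  proof (rule Greatest_equality)
    \<comment> \<open>The Euclidean norm serves as the extremal absolute norm, and the maximum is
      attained at the normalised \<open>?u\<close>.\<close>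
    have "norm ((1 / norm ?u) *\<^sub>R ?u) = 1" "norm (A *v ((1 / norm ?u) *\<^sub>R ?u)) = 2"
      using u by (simp_all add: matrix_vector_mult_scaleR)
    then show "\<exists>x. norm x \<le> 1 \<and> 2 = norm (A *v x)"
      by (metis order_refl)
    show "r \<le> 2" if "\<exists>x. norm x \<le> 1 \<and> r = norm (A *v x)" for r
      using that upper by (smt (verit))
  qed
  with absolute_norm_norm show "\<exists>N. absolute_norm N \<and> induced_norm N A = 2"
    by blast
qed

end
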